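(* Let $c$ be any function from nonempty strings to positive integers such that $z_{\mathrm{SSsr}}(T) \le c(T) \le z_{\mathrm{End}}(T)$ for every nonempty string $T$. Then for each edit type $\mathrm{edit} \in \{\mathrm{sub}, \mathrm{ins}, \mathrm{del}\}$, $\mathrm{AS}_{\mathrm{edit}}(c,n) = \Omega(n^{2/3})$.
   Context: Strings are over an alphabet $\Sigma$ that is not of bounded size (strings may use arbitrarily many distinct characters). $T[i..j]$ is the substring from position $i$ to $j$. An LZ-style factorization of $T$ is $T = f_1\cdots f_z$ with nonempty phrases, each either a single fresh character (not occurring earlier in $T$) or a copy of a substring occurring earlier. The overlapping LZSS factorization is the greedy one: each phrase $f_k$, starting at position $s=|f_1\cdots f_{k-1}|+1$, is a fresh character if $T[s]$ does not occur in $T[1..s-1]$, and otherwise is the longest prefix of $T[s..n]$ that has an occurrence starting at some position $< s$ (possibly overlapping $f_k$); $z_{\mathrm{SSsr}}(T)$ is its number of phrases. An LZ-End factorization is an LZ-style factorization in which each copied phrase $f_k$ has an occurrence $T[i..j]$ with $j \le |f_1\cdots f_{k-1}|$ and $j = |f_1\cdots f_h|$ for some $h<k$ (i.e., the occurrence ends at the end of an earlier phrase). The greedy LZ-End factorization takes each copied phrase $f_k$ as the longest prefix of the remaining suffix $T[|f_1\cdots f_{k-1}|+1..n]$ that is a suffix of $f_1\cdots f_h$ for some $h<k$ (a fresh single character otherwise); $z_{\mathrm{End}}(T)$ is its number of phrases. For a measure $c$, $\mathrm{AS}_{\mathrm{edit}}(c,n) = \max\{c(T')-c(T)\}$ over all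 strings $T$ of length $n$ and all $T'$ obtained from $T$ by a single edit of the given type (substitution, insertion or deletion of one character). $\Omega(n^{2/3})$ means there is a constant $C>0$ with $\mathrm{AS}_{\mathrm{edit}}(c,n) \ge C n^{2/3}$ for infinitely many $n$. *)

theory Defs
  imports Complex_Main "HOL-Library.Sublist" "HOL-Library.Infinite_Set"
begin

text \<open>
  Throughout, \<open>p\<close> is the part of the string that is already factorized and \<open>r\<close> is the
  non-empty remaining suffix, so the whole string is \<open>p @ r\<close> and the next phrase starts at
  (0-based) position \<open>length p\<close>.  The copied phrase below is a prefix of \<open>r\<close>, hence the
  longest one is unique; its source may overlap it, because it is searched for in \<open>p @ r\<close>.
\<close>

lemma prefix_drop: "prefix f r \<Longrightarrow> f @ drop (length f) r = r"
  by (auto simp: prefix_def)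

definition lzss_copy :: "'a list \<Rightarrow> 'a list \<Rightarrow> 'a list \<Rightarrow> bool" where
  "lzss_copy p r w \<longleftrightarrow> prefix w r \<and> (\<exists>i < length p. prefix w (drop i (p @ r)))"

definition lzss_phrase :: "'a list \<Rightarrow> 'a list \<Rightarrow> 'a list" where
  "lzss_phrase p r =
     (if hd r \<notin> set p then [hd r] else (ARG_MAX length w. lzss_copy p r w))"

lemma arg_max_prefix:
  assumes "P x" and "\<And>w. P w \<Longrightarrow> prefix w r"
  shows "P (ARG_MAX length w. P w)" "P w \<Longrightarrow> length w \<le> length (ARG_MAX length w. P w)"
proof -
  have b: "\<forall>y. P y \<longrightarrow> length y < Suc (length r)"
    using assms(2) prefix_length_le by (metis less_Suc_eq_le)
  show "P (ARG_MAX length w. P w)"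
    using arg_max_nat_lemma[OF assms(1) b] by blast
  show "P w \<Longrightarrow> length w \<le> length (ARG_MAX length w. P w)"
    using arg_max_nat_lemma[OF assms(1) b] by blast
qed

lemma lzss_phrase:
  assumes "r \<noteq> []"
  shows "prefix (lzss_phrase p r) r" "lzss_phrase p r \<noteq> []"
proof -
  have 0: "prefix [hd r] r"
    using assms by (cases r) auto
  have "prefix (lzss_phrase p r) r \<and> lzss_phrase p r \<noteq> []"
  proof (cases "hd r \<in> set p")
    case False
    then show ?thesis using 0 by (simp add: lzss_phrase_def)
  next
    case True
    then obtain i where i: "i < length p" "p ! i = hd r"
      by (meson in_set_conv_nth)
    then have "drop i (p @ r) = hd r # drop (Suc i) (p @ r)"
      by (metis Cons_nth_drop_Suc length_append nth_append trans_less_add1)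
    then have c: "lzss_copy p r [hd r]"
      using i 0 by (auto simp: lzss_copy_def)
    have pr: "prefix w r" if "lzss_copy p r w" for w
      using that by (simp add: lzss_copy_def)
    have "prefix (ARG_MAX length w. lzss_copy p r w) r"
      using arg_max_prefix(1)[of "lzss_copy p r", OF c pr] pr by blast
    moreover have "length [hd r] \<le> length (ARG_MAX length w. lzss_copy p r w)"
      by (rule arg_max_prefix(2)[of "lzss_copy p r", OF c pr c])
    ultimately show ?thesis using True by (auto simp: lzss_phrase_def)
  qed
  then show "prefix (lzss_phrase p r) r" "lzss_phrase p r \<noteq> []" by auto
qed

function lzss_from :: "'a list \<Rightarrow> 'a list \<Rightarrow> 'a list list" where
  "lzss_from p r =
     (if r = [] then []
      else let f = lzss_phrase p r in f # lzss_from (p @ f) (drop (length f) r))"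
  by pat_completeness auto
termination
  by (relation "measure (\<lambda>(p, r). length r)") (auto simp: lzss_phrase)

declare lzss_from.simps [simp del]

definition lzss :: "'a list \<Rightarrow> 'a list list" where
  "lzss T = lzss_from [] T"

definition z_SSsr :: "'a list \<Rightarrow> nat" where
  "z_SSsr T = length (lzss T)"

text \<open>
  For LZ-End, \<open>fs\<close> is the list of earlier phrases.  If no non-empty prefix of \<open>r\<close> is
  available for copying, the phrase is a single character; along the factorization this
  character is then always fresh, see \<open>lz_end_phrases\<close> below.
\<close>

definition lz_end_copy :: "'a list list \<Rightarrow> 'a list \<Rightarrow> 'a list \<Rightarrow> bool" where
  "lz_end_copy fs r w \<longleftrightarrow>
     w \<noteq> [] \<and> prefix w r \<and> (\<exists>h \<in> {1..length fs}. suffix w (concat (take h fs)))"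

definition lz_end_phrase :: "'a list list \<Rightarrow> 'a list \<Rightarrow> 'a list" where
  "lz_end_phrase fs r =
     (if \<exists>w. lz_end_copy fs r w then (ARG_MAX length w. lz_end_copy fs r w) else [hd r])"

lemma lz_end_copy_phrase:
  assumes "\<exists>w. lz_end_copy fs r w"
  shows "lz_end_copy fs r (lz_end_phrase fs r)"
proof -
  have pr: "prefix w r" if "lz_end_copy fs r w" for w
    using that by (simp add: lz_end_copy_def)
  obtain w where "lz_end_copy fs r w" using assms by blast
  from arg_max_prefix(1)[of "lz_end_copy fs r", OF this pr] assms show ?thesis
    by (simp add: lz_end_phrase_def)
qed

lemma lz_end_phrase:
  assumes "r \<noteq> []"
  shows "prefix (lz_end_phrase fs r) r" "lz_end_phrase fs r \<noteq> []"
proof -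
  have "prefix (lz_end_phrase fs r) r \<and> lz_end_phrase fs r \<noteq> []"
  proof (cases "\<exists>w. lz_end_copy fs r w")
    case False
    then show ?thesis using assms by (cases r) (auto simp: lz_end_phrase_def)
  next
    case True
    then show ?thesis using lz_end_copy_phrase unfolding lz_end_copy_def by blast
  qed
  then show "prefix (lz_end_phrase fs r) r" "lz_end_phrase fs r \<noteq> []" by auto
qed

function lz_end_from :: "'a list list \<Rightarrow> 'a list \<Rightarrow> 'a list list" where
  "lz_end_from fs r =
     (if r = [] then fs
      else let f = lz_end_phrase fs r in lz_end_from (fs @ [f]) (drop (length f) r))"
  by pat_completeness auto
termination
  by (relation "measure (\<lambda>(fs, r). length r)") (auto simp: lz_end_phrase)

declare lz_end_from.simps [simp del]

definition lz_end :: "'a list \<Rightarrow> 'a list list" where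
  "lz_end T = lz_end_from [] T"

definition z_End :: "'a list \<Rightarrow> nat" where
  "z_End T = length (lz_end T)"

lemma concat_lzss: "concat (lzss T) = T"
proof -
  have "concat (lzss_from p r) = r" for p r :: "'a list"
  proof (induction p r rule: lzss_from.induct)
    case (1 p r)
    show ?case
    proof (cases "r = []")
      case True
      then show ?thesis by (simp add: lzss_from.simps)
    next
      case False
      then show ?thesis
        using "1"[OF False refl] prefix_drop[OF lzss_phrase(1)[OF False, of p]]
        by (subst lzss_from.simps) (simp add: Let_def)
    qed
  qed
  then show ?thesis by (simp add: lzss_def)
qed

lemma concat_lz_end: "concat (lz_end T) = T"
proof -
  have "concat (lz_end_from fs r) = concat fs @ r" for fs :: "'a list list" and r
  proof (induction fs r rule: lz_end_from.induct)
    case (1 fs r)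
    show ?case
    proof (cases "r = []")
      case True
      then show ?thesis by (simp add: lz_end_from.simps)
    next
      case False
      then show ?thesis
        using "1"[OF False refl] prefix_drop[OF lz_end_phrase(1)[OF False, of fs]]
        by (subst lz_end_from.simps) (simp add: Let_def)
    qed
  qed
  then show ?thesis by (simp add: lz_end_def)
qed

lemma lz_end_phrases:
  assumes "k < length (lz_end T)"
  shows "(\<exists>h \<in> {1..k}. suffix (lz_end T ! k) (concat (take h (lz_end T)))) \<or>
         (\<exists>a. lz_end T ! k = [a] \<and> a \<notin> set (concat (take k (lz_end T))))"
proof -
  define ok :: "'a list list \<Rightarrow> nat \<Rightarrow> bool" where
    "ok fs k \<longleftrightarrow> (\<exists>h \<in> {1..k}. suffix (fs ! k) (concat (take h fs))) \<or>
                 (\<exists>a. fs ! k = [a] \<and> a \<notin> set (concat (take k fs)))" for fs k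
  define ends :: "'a list list \<Rightarrow> 'a \<Rightarrow> bool" where
    "ends fs a \<longleftrightarrow> (\<exists>h \<in> {1..length fs}. suffix [a] (concat (take h fs)))" for fs a
  have "\<forall>k < length (lz_end_from fs r). ok (lz_end_from fs r) k"
    if "\<forall>k < length fs. ok fs k" "\<forall>a \<in> set (concat fs). ends fs a" for fs r
    using that
  proof (induction fs r rule: lz_end_from.induct)
    case (1 fs r)
    show ?case
    proof (cases "r = []")
      case True
      then show ?thesis using "1.prems" by (simp add: lz_end_from.simps)
    next
      case False
      define f where "f = lz_end_phrase fs r"
      have ends_mono: "ends (fs @ [f]) a" if "ends fs a" for a
      proof -
        obtain h where "h \<in> {1..length fs}" "suffix [a] (concat (take h fs))"
          using \<open>ends fs a\<close> unfolding ends_def by blast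
        then have "h \<in> {1..length (fs @ [f])}" "suffix [a] (concat (take h (fs @ [f])))"
          by auto
        then show ?thesis unfolding ends_def by blast
      qed
      have new: "(\<exists>h \<in> {1..length fs}. suffix f (concat (take h fs))) \<or>
                 (f = [hd r] \<and> hd r \<notin> set (concat fs))"
      proof (cases "\<exists>w. lz_end_copy fs r w")
        case True
        then have "lz_end_copy fs r f"
          unfolding f_def by (rule lz_end_copy_phrase)
        then show ?thesis by (simp add: lz_end_copy_def)
      next
        case none: False
        have "hd r \<notin> set (concat fs)"
        proof
          assume "hd r \<in> set (concat fs)"
          then have "ends fs (hd r)" using "1.prems"(2) by blast
          then have "lz_end_copy fs r [hd r]"
            using False by (cases r) (auto simp: lz_end_copy_def ends_def)
          then show False using none by blast
        qed
        then show ?thesis using none by (simp add: f_def lz_end_phrase_def)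
      qed
      have "ok (fs @ [f]) k" if "k < length (fs @ [f])" for k
      proof (cases "k < length fs")
        case True
        then have "ok fs k" using "1.prems"(1) by blast
        then show ?thesis using True by (auto simp: ok_def nth_append)
      next
        case False
        then have "k = length fs" using that by simp
        then show ?thesis using new by (auto simp: ok_def)
      qed
      moreover have "ends (fs @ [f]) a" if "a \<in> set (concat (fs @ [f]))" for a
      proof (cases "a \<in> set (concat fs)")
        case True
        then show ?thesis using "1.prems"(2) ends_mono by blast
      next
        case notin: False
        then have "a \<in> set f" using that by auto
        have "f = [hd r]"
        proof (rule ccontr)
          assume "f \<noteq> [hd r]"
          then obtain h where "suffix f (concat (take h fs))" using new by blast
          then have "a \<in> set (concat (take h fs))"
            using \<open>a \<in> set f\<close> set_mono_suffix by blast
          then show False using notin by (auto dest: in_set_takeD)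
        qed
        then have "suffix [a] (concat (take (Suc (length fs)) (fs @ [f])))"
          using \<open>a \<in> set f\<close> by (simp add: suffix_def)
        then show ?thesis unfolding ends_def by force
      qed
      ultimately have "\<forall>k < length (lz_end_from (fs @ [f]) (drop (length f) r)).
          ok (lz_end_from (fs @ [f]) (drop (length f) r)) k"
        using "1.IH"[OF False f_def] by blast
      then show ?thesis
        using False by (subst (1 2) lz_end_from.simps) (simp add: Let_def f_def)
    qed
  qed
  from this[of "[]" T] have "ok (lz_end T) k"
    using assms by (simp add: lz_end_def)
  then show ?thesis unfolding ok_def .
qed

lemma z_End_le_length: "z_End T \<le> length T"
proof -
  have "length (lz_end_from fs r) \<le> length fs + length r" for fs :: "'a list list" and r
  proof (induction fs r rule: lz_end_from.induct)
    case (1 fs r)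
    show ?case
    proof (cases "r = []")
      case True
      then show ?thesis by (simp add: lz_end_from.simps)
    next
      case False
      let ?f = "lz_end_phrase fs r"
      have "0 < length ?f" "length ?f \<le> length r"
        using lz_end_phrase[OF False, of fs] prefix_length_le by auto
      moreover have "length (lz_end_from fs r) =
          length (lz_end_from (fs @ [?f]) (drop (length ?f) r))"
        using False by (subst lz_end_from.simps) (simp add: Let_def)
      moreover have "length (lz_end_from (fs @ [?f]) (drop (length ?f) r))
          \<le> Suc (length fs) + (length r - length ?f)"
        using "1"[OF False refl] by (simp del: add_Suc_right)
      ultimately show ?thesis by linarith
    qed
  qed
  from this[of "[]" T] show ?thesis by (simp add: z_End_def lz_end_def)
qed

datatype edit = Sub | Ins | Del

text \<open>A substitution puts a different character, so an edited string is never \<open>T\<close> itself.\<close>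

fun edited :: "edit \<Rightarrow> 'a list \<Rightarrow> 'a list \<Rightarrow> bool" where
  "edited Sub T T' \<longleftrightarrow> (\<exists>u a b v. a \<noteq> b \<and> T = u @ a # v \<and> T' = u @ b # v)"
| "edited Ins T T' \<longleftrightarrow> (\<exists>u b v. T = u @ v \<and> T' = u @ b # v)"
| "edited Del T T' \<longleftrightarrow> (\<exists>u a v. T = u @ a # v \<and> T' = u @ v)"

text \<open>
  String measures are only meant to be applied to non-empty strings, which excludes
  \<open>n = 0\<close>, and the deletion of the only character when \<open>n = 1\<close>.
\<close>

definition AS_diffs :: "edit \<Rightarrow> ('a list \<Rightarrow> nat) \<Rightarrow> nat \<Rightarrow> int set" where
  "AS_diffs e c n =
     {int (c T') - int (c T) | T T'. length T = n \<and> edited e T T' \<and> T \<noteq> [] \<and> T' \<noteq> []}"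

definition AS :: "edit \<Rightarrow> ('a list \<Rightarrow> nat) \<Rightarrow> nat \<Rightarrow> int" where
  "AS e c n = Max (AS_diffs e c n)"

text \<open>
  Over an infinite alphabet there are infinitely many strings of length \<open>n\<close>; the maximum
  nevertheless exists for the measures considered here.
\<close>

lemma length_edited: "edited e T T' \<Longrightarrow> length T' \<le> Suc (length T)"
  by (cases e) auto

lemma finite_AS_diffs:
  assumes "\<And>T. T \<noteq> [] \<Longrightarrow> c T \<le> z_End T"
  shows "finite (AS_diffs e c n)"
proof (rule finite_subset)
  show "AS_diffs e c n \<subseteq> {- int n .. int (Suc n)}"
  proof
    fix x assume "x \<in> AS_diffs e c n"
    then obtain T T' where x: "x = int (c T') - int (c T)" and T: "length T = n"
      "edited e T T'" "T \<noteq> []" "T' \<noteq> []"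
      by (auto simp: AS_diffs_def)
    have "c T \<le> n"
      using assms[OF T(3)] z_End_le_length[of T] T(1) by linarith
    moreover have "c T' \<le> Suc n"
      using assms[OF T(4)] z_End_le_length[of T'] length_edited[OF T(2)] T(1) by linarith
    ultimately show "x \<in> {- int n .. int (Suc n)}" using x by simp
  qed
qed simp

lemma AS_diffs_nonempty:
  assumes "n \<ge> 2" and "infinite (UNIV :: 'a set)"
  shows "AS_diffs e (c :: 'a list \<Rightarrow> nat) n \<noteq> {}"
proof -
  obtain a b :: 'a where ab: "a \<noteq> b"
    using assms(2) by (metis (full_types) finite.simps UNIV_eq_I insertI1 finite_insert)
  define v where "v = replicate (n - 1) a"
  have v: "length (a # v) = n" "v \<noteq> []"
    using assms(1) by (auto simp: v_def)
  have "\<exists>T'. edited e (a # v) T' \<and> T' \<noteq> []"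
  proof (cases e)
    case Sub
    have "a # v = [] @ a # v" "b # v = [] @ b # v" by simp_all
    then have "edited e (a # v) (b # v)" unfolding Sub edited.simps using ab by blast
    then show ?thesis by blast
  next
    case Ins
    have "a # v = [] @ (a # v)" "b # a # v = [] @ b # (a # v)" by simp_all
    then have "edited e (a # v) (b # a # v)" unfolding Ins edited.simps by blast
    then show ?thesis by blast
  next
    case Del
    have "a # v = [] @ a # v" "v = [] @ v" by simp_all
    then have "edited e (a # v) v" unfolding Del edited.simps by blast
    then show ?thesis using v(2) by blast
  qed
  then obtain T' where "edited e (a # v) T'" "T' \<noteq> []" by blast
  then have "int (c T') - int (c (a # v)) \<in> AS_diffs e c n"
    using v(1) unfolding AS_diffs_def by blast
  then show ?thesis by blast
qed

end

theory Submission
  imports Defs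
begin

text \<open>
  Let the original string begin with a word of pairwise distinct characters containing the
  adjacent characters \<open>c d\<close>, and let it continue with all words \<open>u c d v\<close> around this pair
  that take \<open>i\<close> characters on the left and \<open>j\<close> on the right, \<open>i, j < L\<close>, each followed by a
  fresh delimiter.  Every character of the initial word is a phrase of its own, so all its
  positions are phrase ends and LZ-End copies each block at once: two phrases per block.
  An edit that destroys the pair \<open>c d\<close> in the initial word removes this source.  The blocks are
  ordered by \<open>i\<close> and then by \<open>j\<close>, so that no block occurs inside an earlier one;
  hence every block now costs three phrases even for LZSS.  There are \<open>L\<^sup>2\<close> blocks of
  length \<open>O(L)\<close>, so the gain is of order \<open>L\<^sup>2\<close> for strings of length \<open>O(L\<^sup>3)\<close>.
\<close>

section \<open>Delimited words and separation\<close>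

definition delimited :: "('a list \<times> 'a) list \<Rightarrow> 'a list" where
  "delimited bs = concat (map (\<lambda>(w, s). w @ [s]) bs)"

lemma delimited_simps [simp]:
  "delimited [] = []"
  "delimited ((w, s) # bs) = w @ s # delimited bs"
  "delimited (bs @ bs') = delimited bs @ delimited bs'"
  by (simp_all add: delimited_def)

lemma set_delimited: "set (delimited bs) = (\<Union>(w, s)\<in>set bs. insert s (set w))"
  by (auto simp: delimited_def)

text \<open>
  Holds between an earlier block and a later one.  The condition on the underlying sets is
  what prevents a later block from being copied from an earlier one.
\<close>

definition separated :: "'a list \<times> 'a \<Rightarrow> 'a list \<times> 'a \<Rightarrow> bool" where
  "separated = (\<lambda>(v, t) (w, s). t \<notin> set w \<and> \<not> set w \<subseteq> set v \<and> s \<noteq> t \<and> s \<notin> set v)"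

subsection \<open>LZSS\<close>

lemma lzss_from_Nil [simp]: "lzss_from p [] = []"
  by (simp add: lzss_from.simps)

lemma lzss_from_step:
  "r \<noteq> [] \<Longrightarrow> lzss_from p r =
     lzss_phrase p r # lzss_from (p @ lzss_phrase p r) (drop (length (lzss_phrase p r)) r)"
  by (subst lzss_from.simps) (simp add: Let_def)

lemma lzss_phrase_cases:
  assumes "r \<noteq> []"
  shows "lzss_phrase p r = [hd r] \<or> lzss_copy p r (lzss_phrase p r)"
proof (cases "hd r \<in> set p")
  case True
  then obtain i where i: "i < length p" "p ! i = hd r"
    by (meson in_set_conv_nth)
  then have "drop i (p @ r) = hd r # drop (Suc i) (p @ r)"
    by (metis Cons_nth_drop_Suc length_append nth_append trans_less_add1)
  then have c: "lzss_copy p r [hd r]"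
    using i assms by (cases r) (auto simp: lzss_copy_def)
  have "prefix w r" if "lzss_copy p r w" for w
    using that by (simp add: lzss_copy_def)
  with c have "lzss_copy p r (ARG_MAX length w. lzss_copy p r w)"
    by (rule arg_max_prefix(1))
  then show ?thesis using True by (simp add: lzss_phrase_def)
qed (simp add: lzss_phrase_def)

text \<open>A source starts at some \<open>i < length p\<close>. If \<open>f\<close> reached the
  delimiter \<open>s\<close>, the character aligned with \<open>s\<close> in the source would sit at
  position \<open>i + length w\<close>, still inside \<open>p @ w\<close>, where \<open>s\<close>
  does not occur.\<close>

lemma lzss_copy_before_fresh:
  assumes "lzss_copy p (w @ s # r) f" "s \<notin> set (p @ w)"
  shows "prefix f w"
proof -
  obtain i where i: "i < length p" "prefix f (drop i (p @ w @ s # r))"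
    and f: "prefix f (w @ s # r)"
    using assms(1) by (auto simp: lzss_copy_def)
  have "length f \<le> length w"
  proof (rule ccontr)
    assume "\<not> length f \<le> length w"
    then have l: "length w < length f" by simp
    have nth_f: "f ! length w = x ! length w" if "prefix f x" for x
      using that l by (auto simp: prefix_def nth_append)
    have "f ! length w = s"
      using nth_f[OF f] by simp
    moreover have "f ! length w = drop i (p @ w @ s # r) ! length w"
      using nth_f[OF i(2)] .
    moreover have "drop i (p @ w @ s # r) ! length w = ((p @ w) @ s # r) ! (i + length w)"
      using i(1) by (subst nth_drop) simp_all
    moreover have "((p @ w) @ s # r) ! (i + length w) = (p @ w) ! (i + length w)"
      using i(1) by (subst nth_append) simp
    moreover have "(p @ w) ! (i + length w) \<in> set (p @ w)"
      using i(1) by (intro nth_mem) simp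
    ultimately show False using assms(2) by simp
  qed
  then show ?thesis using f by (meson prefix_length_prefix prefixI)
qed

text \<open>A source that starts strictly earlier also ends strictly earlier, so even a
  self-overlapping one avoids the last character of \<open>w\<close>.\<close>

lemma lzss_copy_imp_sublist:
  assumes "lzss_copy p (w @ r) w" "w \<noteq> []"
  shows "sublist w (p @ butlast w)"
proof -
  obtain i where i: "i < length p" "prefix w (drop i (p @ w @ r))"
    using assms(1) by (auto simp: lzss_copy_def)
  have "w = take (length w) (drop i (p @ w @ r))"
    using i(2) unfolding prefix_def by (metis append_eq_conv_conj)
  also have "\<dots> = take (length w) (drop i (p @ butlast w))"
  proof (rule nth_equalityI)
    show "length (take (length w) (drop i (p @ w @ r)))
        = length (take (length w) (drop i (p @ butlast w)))"
      using i(1) by simp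
  next
    fix k assume "k < length (take (length w) (drop i (p @ w @ r)))"
    then have "k < length w" by (simp only: length_take)
    then show "take (length w) (drop i (p @ w @ r)) ! k
        = take (length w) (drop i (p @ butlast w)) ! k"
      using i(1) by (auto simp: nth_append nth_butlast)
  qed
  finally have "prefix w (drop i (p @ butlast w))"
    by (metis take_is_prefix)
  then show ?thesis
    by (metis prefix_imp_sublist suffix_drop suffix_imp_sublist sublist_order.order.trans)
qed

text \<open>No phrase crosses into \<open>s\<close>, so \<open>s\<close> is a phrase of its own and
  a nonempty \<open>w\<close> accounts for at least one more. The induction peels off the first
  phrase, which is a prefix of \<open>w\<close>.\<close>

lemma length_lzss_from_fresh:
  assumes "s \<notin> set (p @ w)"
  shows "of_bool (w \<noteq> []) + 1 + length (lzss_from (p @ w @ [s]) r)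
    \<le> length (lzss_from p (w @ s # r))"
  using assms
proof (induction "length w" arbitrary: p w rule: less_induct)
  case less
  show ?case
  proof (cases "w = []")
    case True
    then show ?thesis using less.prems by (simp add: lzss_from_step lzss_phrase_def)
  next
    case False
    define f where "f = lzss_phrase p (w @ s # r)"
    have "f = [hd w] \<or> prefix f w"
      using lzss_phrase_cases[of "w @ s # r" p] lzss_copy_before_fresh[OF _ less.prems] False
      unfolding f_def by auto
    then have "prefix f w" using False by (cases w) auto
    then obtain v where w: "w = f @ v" by (auto simp: prefix_def)
    have "f \<noteq> []" unfolding f_def by (simp add: lzss_phrase)
    then have "1 + length (lzss_from ((p @ f) @ v @ [s]) r) \<le> length (lzss_from (p @ f) (v @ s # r))"
      using less.hyps[of v "p @ f"] less.prems by (auto simp: w)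
    moreover have "lzss_from p (w @ s # r) = f # lzss_from (p @ f) (v @ s # r)"
      using lzss_from_step[of "w @ s # r" p] by (simp flip: f_def) (simp add: w)
    ultimately show ?thesis using False w by simp
  qed
qed

text \<open>The first phrase cannot be all of \<open>w\<close>: a copy would make \<open>w\<close> a
  factor of \<open>p @ butlast w\<close>, and a single character is too short. So \<open>w\<close>
  costs at least two phrases and \<open>s\<close> a third.\<close>

lemma length_lzss_from_new_block:
  assumes "s \<notin> set (p @ w)" "2 \<le> length w" "\<not> sublist w (p @ butlast w)"
  shows "3 + length (lzss_from (p @ w @ [s]) r) \<le> length (lzss_from p (w @ s # r))"
proof -
  have "w \<noteq> []" using assms(2) by auto
  define f where "f = lzss_phrase p (w @ s # r)"
  have "f = [hd w] \<or> prefix f w \<and> f \<noteq> w"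
    using lzss_phrase_cases[of "w @ s # r" p] lzss_copy_before_fresh[OF _ assms(1)] assms(3) \<open>w \<noteq> []\<close>
      lzss_copy_imp_sublist[of p w "s # r"]
    unfolding f_def by auto
  then have "prefix f w" "f \<noteq> w" using assms(2) by (cases w; auto)+
  then obtain v where w: "w = f @ v" "v \<noteq> []" by (auto simp: prefix_def)
  have "2 + length (lzss_from ((p @ f) @ v @ [s]) r) \<le> length (lzss_from (p @ f) (v @ s # r))"
    using length_lzss_from_fresh[of s "p @ f" v r] assms(1) w by simp
  moreover have "lzss_from p (w @ s # r) = f # lzss_from (p @ f) (v @ s # r)"
    using lzss_from_step[of "w @ s # r" p] by (simp flip: f_def) (simp add: w)
  ultimately show ?thesis using w by simp
qed

lemma sublist_append_ConsD:
  assumes "sublist w (x @ s # y)" "s \<notin> set w"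
  shows "sublist w x \<or> sublist w y"
proof -
  obtain a b where e: "x @ s # y = a @ w @ b" using assms(1) by (auto simp: sublist_def)
  then obtain us where "x @ us = a \<and> s # y = us @ w @ b \<or> x = a @ us \<and> us @ s # y = w @ b"
    by (auto simp: append_eq_append_conv2)
  then show ?thesis
  proof (elim disjE conjE)
    assume "s # y = us @ w @ b"
    then have "w = [] \<or> (\<exists>us'. y = us' @ w @ b)"
      using assms(2) by (auto simp: Cons_eq_append_conv)
    then show ?thesis by auto
  next
    assume "x = a @ us" "us @ s # y = w @ b"
    then show ?thesis
      using assms(2) by (auto simp: append_eq_append_conv2 Cons_eq_append_conv)
  qed
qed

text \<open>An occurrence of \<open>w\<close> contains no delimiter, so it lies within one
  \<open>v\<close> or within \<open>y\<close>; the former would give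
  \<open>set w \<subseteq> set v\<close>.\<close>

lemma not_sublist_delimited:
  assumes "\<forall>(v, t)\<in>set bs. t \<notin> set w \<and> \<not> set w \<subseteq> set v" "\<not> sublist w y"
  shows "\<not> sublist w (delimited bs @ y)"
  using assms
proof (induction bs)
  case (Cons b bs)
  obtain v t where b: "b = (v, t)" by fastforce
  then have "\<not> sublist w v" using Cons.prems(1) set_mono_sublist by fastforce
  then show ?case using Cons b sublist_append_ConsD[of w v t "delimited bs @ y"] by auto
qed simp

text \<open>The blocks already parsed are kept in \<open>as\<close>. Separation from them makes the
  next delimiter fresh and the next word new, so each block costs three phrases.\<close>

lemma length_lzss_from_delimited:
  assumes "sorted_wrt separated (as @ bs)" "\<forall>(w, s)\<in>set bs. 2 \<le> length w \<and> s \<notin> set w"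
  shows "3 * length bs \<le> length (lzss_from (delimited as) (delimited bs))"
  using assms
proof (induction bs arbitrary: as)
  case (Cons b bs)
  obtain w s where b: "b = (w, s)" by fastforce
  have sep: "\<forall>(v, t)\<in>set as. t \<notin> set w \<and> \<not> set w \<subseteq> set v \<and> s \<noteq> t \<and> s \<notin> set v"
    using Cons.prems(1) b by (fastforce simp: sorted_wrt_append separated_def)
  have w: "2 \<le> length w" "s \<notin> set w" using Cons.prems(2) b by auto
  \<comment> \<open>This covers the part of a self-overlapping source that lies inside
    \<open>w\<close> itself.\<close>
  have "\<not> sublist w (butlast w)"
    using sublist_length_le[of w "butlast w"] w(1) by auto
  then have "\<not> sublist w (delimited as @ butlast w)"
    using sep by (intro not_sublist_delimited) auto
  moreover have "s \<notin> set (delimited as @ w)"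
    using sep w by (auto simp: set_delimited)
  ultimately have "3 + length (lzss_from (delimited as @ w @ [s]) (delimited bs))
      \<le> length (lzss_from (delimited as) (w @ s # delimited bs))"
    using w by (intro length_lzss_from_new_block)
  moreover have "3 * length bs \<le> length (lzss_from (delimited (as @ [b])) (delimited bs))"
    using Cons.prems by (intro Cons.IH) auto
  ultimately show ?case using b by simp
qed simp

corollary z_SSsr_delimited:
  assumes "sorted_wrt separated bs" "\<forall>(w, s)\<in>set bs. 2 \<le> length w \<and> s \<notin> set w"
  shows "3 * length bs \<le> z_SSsr (delimited bs)"
  using length_lzss_from_delimited[of "[]" bs] assms by (simp add: z_SSsr_def lzss_def)

subsection \<open>LZ-End\<close>

lemma lz_end_from_Nil [simp]: "lz_end_from fs [] = fs"
  by (simp add: lz_end_from.simps)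

lemma lz_end_from_step:
  "r \<noteq> [] \<Longrightarrow> lz_end_from fs r =
     lz_end_from (fs @ [lz_end_phrase fs r]) (drop (length (lz_end_phrase fs r)) r)"
  by (subst lz_end_from.simps) (simp add: Let_def)

lemma lz_end_copy_subset: "lz_end_copy fs r w \<Longrightarrow> set w \<subseteq> set (concat fs)"
  by (fastforce simp: lz_end_copy_def dest: set_mono_suffix in_set_takeD)

lemma lz_end_from_fresh:
  assumes "s \<notin> set (concat fs)"
  shows "lz_end_from fs (s # r) = lz_end_from (fs @ [[s]]) r"
proof -
  have "\<not> lz_end_copy fs (s # r) w" for w
  proof
    assume c: "lz_end_copy fs (s # r) w"
    then have "s \<in> set w" by (auto simp: lz_end_copy_def prefix_Cons)
    then show False using lz_end_copy_subset[OF c] assms by blast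
  qed
  then show ?thesis by (simp add: lz_end_from_step lz_end_phrase_def)
qed

lemma lz_end_from_distinct:
  assumes "distinct B" "set B \<inter> set (concat fs) = {}"
  shows "lz_end_from fs (B @ r) = lz_end_from (fs @ map (\<lambda>x. [x]) B) r"
  using assms
proof (induction B arbitrary: fs)
  case (Cons x B)
  then have "lz_end_from fs ((x # B) @ r) = lz_end_from (fs @ [[x]]) (B @ r)"
    by (simp add: lz_end_from_fresh)
  also have "\<dots> = lz_end_from ((fs @ [[x]]) @ map (\<lambda>x. [x]) B) r"
    using Cons.prems by (intro Cons.IH) auto
  finally show ?case by simp
qed simp

text \<open>As \<open>B\<close> is parsed into single characters, every factor of \<open>B\<close>
  ends at a phrase end and can be copied whole. The copy stops before the fresh \<open>s\<close>,
  which becomes the second phrase.\<close>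

lemma lz_end_from_block:
  assumes "w \<noteq> []" "sublist w B" "s \<notin> set (concat (map (\<lambda>x. [x]) B @ fs))"
  shows "lz_end_from (map (\<lambda>x. [x]) B @ fs) (w @ s # r)
    = lz_end_from (map (\<lambda>x. [x]) B @ fs @ [w, [s]]) r"
proof -
  let ?fs = "map (\<lambda>x. [x]) B @ fs"
  obtain x y where B: "B = x @ w @ y" using assms(2) by (auto simp: sublist_def)
  \<comment> \<open>The witness for \<open>h\<close> is \<open>length (x @ w)\<close>, since the
    phrases of \<open>B\<close> are singletons.\<close>
  have "concat (take (length (x @ w)) ?fs) = x @ w"
    by (simp add: B)
  moreover have "length (x @ w) \<in> {1..length ?fs}"
    using assms(1) by (cases w) (auto simp: B)
  moreover have "suffix w (x @ w)" by (simp add: suffix_def)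
  ultimately have c: "lz_end_copy ?fs (w @ s # r) w"
    using assms(1) unfolding lz_end_copy_def by (metis prefixI)
  define f where "f = lz_end_phrase ?fs (w @ s # r)"
  have f: "lz_end_copy ?fs (w @ s # r) f"
    unfolding f_def using c by (intro lz_end_copy_phrase) blast
  have "length w \<le> length (ARG_MAX length w'. lz_end_copy ?fs (w @ s # r) w')"
    using c by (rule arg_max_prefix(2)) (use c in \<open>auto simp: lz_end_copy_def\<close>)
  then have "length w \<le> length f"
    using c by (auto simp: f_def lz_end_phrase_def)
  moreover have "prefix f (w @ s # r)" "s \<notin> set f"
    using f lz_end_copy_subset[OF f] assms(3) by (auto simp: lz_end_copy_def)
  ultimately have "length w \<le> length f" "prefix f w"
    by (auto simp: prefix_append prefix_Cons)
  then have "f = w"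
    by (auto simp: prefix_def)
  then have "lz_end_from ?fs (w @ s # r) = lz_end_from (?fs @ [w]) (s # r)"
    by (subst lz_end_from_step) (simp_all flip: f_def)
  also have "\<dots> = lz_end_from ((?fs @ [w]) @ [[s]]) r"
    using assms(3) B by (intro lz_end_from_fresh) auto
  finally show ?thesis by simp
qed

lemma length_lz_end_from_delimited:
  assumes "sorted_wrt separated bs" "\<forall>(w, s)\<in>set bs. w \<noteq> [] \<and> sublist w B"
    "\<forall>(w, s)\<in>set bs. s \<notin> set B \<union> set (concat fs)"
  shows "length (lz_end_from (map (\<lambda>x. [x]) B @ fs) (delimited bs))
    = length B + length fs + 2 * length bs"
  using assms
proof (induction bs arbitrary: fs)
  case (Cons b bs)
  obtain w s where b: "b = (w, s)" by fastforce
  have "lz_end_from (map (\<lambda>x. [x]) B @ fs) (delimited (b # bs))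
      = lz_end_from (map (\<lambda>x. [x]) B @ fs @ [w, [s]]) (delimited bs)"
    using Cons.prems b by (auto intro!: lz_end_from_block)
  moreover have "length (lz_end_from (map (\<lambda>x. [x]) B @ fs @ [w, [s]]) (delimited bs))
      = length B + length (fs @ [w, [s]]) + 2 * length bs"
    using Cons.prems b by (intro Cons.IH) (fastforce simp: separated_def)+
  ultimately show ?case by simp
qed simp

corollary z_End_delimited:
  assumes "distinct B" "sorted_wrt separated bs" "\<forall>(w, s)\<in>set bs. w \<noteq> [] \<and> sublist w B"
    "\<forall>(w, s)\<in>set bs. s \<notin> set B"
  shows "z_End (B @ delimited bs) = length B + 2 * length bs"
  using length_lz_end_from_delimited[of bs B "[]"] lz_end_from_distinct[of B "[]"] assms
  by (simp add: z_End_def lz_end_def)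

subsection \<open>The strings\<close>

text \<open>
  The critical pair is \<open>g L, g (L + 1)\<close>.  Block \<open>k\<close> extends it by \<open>k div L\<close> characters to the
  left and \<open>k mod L\<close> to the right, which realizes the lexicographic order of the extents.
\<close>

definition block :: "(nat \<Rightarrow> 'a) \<Rightarrow> nat \<Rightarrow> nat \<Rightarrow> 'a list \<times> 'a" where
  "block g L k = (map g [L - k div L..<L + 2 + k mod L], g (2 * L + 3 + k))"

definition blocks :: "(nat \<Rightarrow> 'a) \<Rightarrow> nat \<Rightarrow> ('a list \<times> 'a) list" where
  "blocks g L = map (block g L) [0..<L * L]"

lemma length_blocks [simp]: "length (blocks g L) = L * L"
  by (simp add: blocks_def)

lemma block_bounds:
  fixes k L :: nat
  assumes "k < L * L"
  shows "k div L < L" "k mod L < L"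
proof -
  have "0 < L" using assms by (cases L) auto
  then show "k div L < L" "k mod L < L"
    using assms by (auto simp: less_mult_imp_div_less)
qed

text \<open>If the index interval of block \<open>l\<close> were contained in that of block
  \<open>k\<close>, both \<open>l div L \<le> k div L\<close> and
  \<open>l mod L \<le> k mod L\<close> would hold, forcing \<open>l \<le> k\<close>. Delimiter
  indices exceed all word indices.\<close>

lemma separated_block:
  assumes "inj g" "k < l" "l < L * L"
  shows "separated (block g L k) (block g L l)"
proof -
  have b: "k div L < L" "k mod L < L" "l div L < L" "l mod L < L"
    using assms block_bounds[of k L] block_bounds[of l L] by auto
  have "\<not> {L - l div L..<L + 2 + l mod L} \<subseteq> {L - k div L..<L + 2 + k mod L}"
  proof
    assume "{L - l div L..<L + 2 + l mod L} \<subseteq> {L - k div L..<L + 2 + k mod L}"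
    moreover have "L - l div L < L + 2 + l mod L" by simp
    ultimately have "L - k div L \<le> L - l div L" "l mod L \<le> k mod L"
      by (simp_all add: atLeastLessThan_subset_iff)
    then have "l div L \<le> k div L" "l mod L \<le> k mod L" using b by linarith+
    then have "l div L * L + l mod L \<le> k div L * L + k mod L"
      by (intro add_mono mult_right_mono) auto
    then show False using assms(2) by simp
  qed
  moreover have "2 * L + 3 + k \<notin> {L - l div L..<L + 2 + l mod L}"
    "2 * L + 3 + l \<notin> {L - k div L..<L + 2 + k mod L}"
    unfolding atLeastLessThan_iff using b by linarith+
  ultimately show ?thesis
    using assms(2) by (simp only: separated_def block_def inj_image_subset_iff[OF assms(1)]
        inj_image_mem_iff[OF assms(1)] inj_eq[OF assms(1)] set_map set_upt prod.case) simp
qed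

lemma sorted_blocks: "inj g \<Longrightarrow> sorted_wrt separated (blocks g L)"
  by (auto simp: blocks_def sorted_wrt_iff_nth_less separated_block)

lemma blocks_wf:
  assumes "inj g" "(w, s) \<in> set (blocks g L)"
  shows "2 \<le> length w" "s \<notin> set w" "g L \<in> set w" "g (Suc L) \<in> set w"
    "sublist w (map g [0..<2 * L + 1])" "set w \<subseteq> g ` {..2 * L}" "s \<in> g ` {2 * L + 3..}"
    "length w \<le> 2 * L + 1"
proof -
  obtain k where k: "k < L * L" "(w, s) = block g L k"
    using assms(2) by (auto simp: blocks_def)
  define a b where "a = L - k div L" and "b = L + 2 + k mod L"
  have ab: "a \<le> L" "L + 2 \<le> b" "b \<le> 2 * L + 1" "1 \<le> a"
    using block_bounds[OF k(1)] unfolding a_def b_def by linarith+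
  have w: "w = map g [a..<b]" and s: "s = g (2 * L + 3 + k)"
    using k(2) by (simp_all add: block_def a_def b_def)
  show "2 \<le> length w" "length w \<le> 2 * L + 1" using ab by (simp_all add: w)
  show "s \<notin> set w" using ab by (simp add: w s inj_image_mem_iff[OF assms(1)])
  show "g L \<in> set w" "g (Suc L) \<in> set w" using ab by (auto simp: w)
  show "set w \<subseteq> g ` {..2 * L}" using ab by (auto simp: w)
  show "s \<in> g ` {2 * L + 3..}" by (auto simp: s)
  have "[0..<2 * L + 1] = [0..<a] @ [a..<b] @ [b..<2 * L + 1]"
    using ab upt_add_eq_append[of 0 a "b - a"] upt_add_eq_append[of 0 b "2 * L + 1 - b"] by simp
  then show "sublist w (map g [0..<2 * L + 1])"
    unfolding w by (metis map_append sublist_def)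
qed

text \<open>Indices \<open>0\<close> to \<open>2 * L\<close> form the initial word and
  \<open>2 * L + 2\<close> its delimiter. Index \<open>2 * L + 1\<close> is left free for the
  character that an edit introduces; block delimiters start at \<open>2 * L + 3\<close>.\<close>

definition original :: "(nat \<Rightarrow> 'a) \<Rightarrow> nat \<Rightarrow> 'a list" where
  "original g L = map g [0..<2 * L + 1] @ g (2 * L + 2) # delimited (blocks g L)"

lemma length_delimited_le:
  "(\<forall>(w, s)\<in>set bs. length w \<le> m) \<Longrightarrow> length (delimited bs) \<le> length bs * (m + 1)"
  by (induction bs) auto

lemma length_original:
  assumes "inj g"
  shows "2 * L \<le> length (original g L)" "length (original g L) \<le> 2 * (L + 1) * (L * L + 1)"
proof -
  have "length (delimited (blocks g L)) \<le> L * L * (2 * L + 1 + 1)"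
    using length_delimited_le[of "blocks g L" "2 * L + 1"] blocks_wf(8)[OF assms] by auto
  then show "2 * L \<le> length (original g L)" "length (original g L) \<le> 2 * (L + 1) * (L * L + 1)"
    by (simp_all add: original_def algebra_simps)
qed

lemma z_End_original:
  assumes "inj g"
  shows "z_End (original g L) = 2 * L + 2 + 2 * (L * L)"
proof -
  \<comment> \<open>The delimiter of the initial word joins \<open>B\<close>: all its characters are
    distinct, so it yields \<open>2 * L + 2\<close> singleton phrases.\<close>
  define B where "B = map g [0..<2 * L + 1] @ [g (2 * L + 2)]"
  have B: "B = map g ([0..<2 * L + 1] @ [2 * L + 2])" by (simp add: B_def)
  have "distinct B"
    unfolding B distinct_map by (intro conjI inj_on_subset[OF assms]) auto
  moreover have "w \<noteq> [] \<and> sublist w B \<and> s \<notin> set B" if block: "(w, s) \<in> set (blocks g L)" for w s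
  proof (intro conjI)
    show "w \<noteq> []" using blocks_wf(1)[OF assms block] by auto
    show "sublist w B"
      unfolding B_def using blocks_wf(5)[OF assms block] by (simp add: sublist_append del: upt_Suc)
    obtain k where "s = g k" "2 * L + 3 \<le> k" using blocks_wf(7)[OF assms block] by auto
    then show "s \<notin> set B"
      by (simp add: B inj_image_mem_iff[OF assms] inj_eq[OF assms] del: upt_Suc)
  qed
  ultimately have "z_End (B @ delimited (blocks g L)) = length B + 2 * length (blocks g L)"
    using sorted_blocks[OF assms] by (intro z_End_delimited) auto
  then show ?thesis by (simp add: original_def B_def)
qed

section \<open>The effect of one edit\<close>

text \<open>Here \<open>as\<close> stands for the initial word after the edit, read as delimited
  words. Every block contains both \<open>g L\<close> and \<open>g (Suc L)\<close>, so a word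
  lacking one of them contains no block. The phrases spent on \<open>as\<close> are dropped from the
  bound.\<close>

lemma z_SSsr_prepend:
  assumes "inj g" "sorted_wrt separated as"
    "\<And>v t. (v, t) \<in> set as \<Longrightarrow> 2 \<le> length v \<and> set v \<subseteq> g ` {..2 * L} \<and> t \<in> g ` {2 * L + 1..2 * L + 2}
       \<and> (g L \<notin> set v \<or> g (Suc L) \<notin> set v)"
  shows "3 * (L * L) \<le> z_SSsr (delimited as @ delimited (blocks g L))"
proof -
  have "separated (v, t) (w, s)"
    if "(v, t) \<in> set as" "(w, s) \<in> set (blocks g L)" for v t w s
    using assms(3)[OF that(1)] blocks_wf[OF assms(1) that(2)]
    by (fastforce simp: separated_def inj_eq[OF assms(1)])
  then have "sorted_wrt separated (as @ blocks g L)"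
    using assms(2) sorted_blocks[OF assms(1)] by (auto simp: sorted_wrt_append)
  moreover have "\<forall>(w, s)\<in>set (as @ blocks g L). 2 \<le> length w \<and> s \<notin> set w"
    using assms(3) blocks_wf(1,2)[OF assms(1)] by (fastforce simp: inj_eq[OF assms(1)])
  ultimately have "3 * length (as @ blocks g L) \<le> z_SSsr (delimited (as @ blocks g L))"
    by (rule z_SSsr_delimited)
  then show ?thesis by simp
qed

text \<open>Substitution turns \<open>c\<close> into the delimiter \<open>b\<close>, insertion puts
  \<open>b\<close> right after \<open>c\<close>, and deletion removes \<open>c\<close>. In each case
  no resulting word has both critical characters; \<open>2 \<le> L\<close> makes these words long
  enough.\<close>

lemma edited_original:
  assumes "inj g" "2 \<le> L"
  shows "\<exists>T'. edited e (original g L) T' \<and> 3 * (L * L) \<le> z_SSsr T'"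
proof -
  define A c D b s where "A = map g [0..<L]" and "c = g L" and "D = map g [L + 1..<2 * L + 1]"
    and "b = g (2 * L + 1)" and "s = g (2 * L + 2)"
  let ?R = "delimited (blocks g L)"
  have "[0..<2 * L + 1] = [0..<L] @ L # [L + 1..<2 * L + 1]"
    using upt_add_eq_append[of 0 L "L + 1"] upt_conv_Cons[of L "2 * L + 1"]
    by (simp add: mult_2)
  then have T: "original g L = A @ c # D @ s # ?R"
    by (simp only: original_def A_def c_def D_def s_def map_append list.map append_assoc append_Cons)
  have [simp]: "length A = L" "length D = L" by (simp_all add: A_def D_def)
  have sets: "set A = g ` {0..<L}" "set D = g ` {L + 1..<2 * L + 1}"
    by (simp_all only: A_def D_def set_map set_upt)
  note mem = inj_image_mem_iff[OF assms(1)] inj_eq[OF assms(1)]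
  have sub: "set A \<subseteq> g ` {..2 * L}" "set D \<subseteq> g ` {..2 * L}" "c \<in> g ` {..2 * L}"
    "b \<in> g ` {2 * L + 1..2 * L + 2}" "s \<in> g ` {2 * L + 1..2 * L + 2}"
    by (auto simp: sets c_def b_def s_def)
  have notin: "c \<notin> set A" "c \<notin> set D" "g (Suc L) \<notin> set A" "g (Suc L) \<in> set D" "g (Suc L) \<noteq> c"
    "b \<notin> set D" "s \<notin> set A" "s \<noteq> b" "s \<noteq> c" "c \<noteq> b"
    using assms(2) by (auto simp: sets c_def b_def s_def mem)
  show ?thesis
  proof (cases e)
    case Sub
    let ?T' = "delimited [(A, b), (D, s)] @ ?R"
    have "original g L = A @ c # D @ s # ?R" "?T' = A @ b # D @ s # ?R"
      by (simp_all add: T)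
    then have "edited Sub (original g L) ?T'"
      unfolding edited.simps using \<open>c \<noteq> b\<close> by blast
    moreover have "3 * (L * L) \<le> z_SSsr ?T'"
      using assms sub notin
      by (intro z_SSsr_prepend) (auto simp: separated_def simp flip: c_def)
    ultimately show ?thesis using Sub by blast
  next
    case Ins
    let ?T' = "delimited [(A @ [c], b), (D, s)] @ ?R"
    have "original g L = (A @ [c]) @ D @ s # ?R" "?T' = (A @ [c]) @ b # D @ s # ?R"
      by (simp_all add: T)
    then have "edited Ins (original g L) ?T'"
      unfolding edited.simps by blast
    moreover have "3 * (L * L) \<le> z_SSsr ?T'"
      using assms sub notin
      by (intro z_SSsr_prepend) (auto simp: separated_def simp flip: c_def)
    ultimately show ?thesis using Ins by blast
  next
    case Del
    let ?T' = "delimited [(A @ D, s)] @ ?R"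
    have "original g L = A @ c # D @ s # ?R" "?T' = A @ D @ s # ?R"
      by (simp_all add: T)
    then have "edited Del (original g L) ?T'"
      unfolding edited.simps by blast
    moreover have "3 * (L * L) \<le> z_SSsr ?T'"
      using assms sub notin
      by (intro z_SSsr_prepend) (auto simp: separated_def simp flip: c_def)
    ultimately show ?thesis using Del by blast
  qed
qed

section \<open>The lower bound on the sensitivity\<close>

text \<open>The bound is \<open>3 * L * L\<close>, from LZSS after the edit, minus
  \<open>2 * L + 2 + 2 * L * L\<close>, from LZ-End before it. Finiteness of the set of differences
  lets \<open>Max\<close> bound this one.\<close>

lemma AS_original:
  fixes c :: "'a list \<Rightarrow> nat" and g :: "nat \<Rightarrow> 'a"
  assumes "inj g" "2 \<le> L"
    and "\<And>T. T \<noteq> [] \<Longrightarrow> z_SSsr T \<le> c T"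
    and "\<And>T. T \<noteq> [] \<Longrightarrow> c T \<le> z_End T"
  shows "int (L * L) - 2 * int L - 2 \<le> AS e c (length (original g L))"
proof -
  let ?T = "original g L"
  obtain T' where T': "edited e ?T T'" "3 * (L * L) \<le> z_SSsr T'"
    using edited_original[OF assms(1,2)] by blast
  have "T' \<noteq> []" using T'(2) assms(2) by (auto simp: z_SSsr_def lzss_def)
  have "?T \<noteq> []" by (simp add: original_def)
  have "int (c T') - int (c ?T) \<in> AS_diffs e c (length ?T)"
    using T'(1) \<open>T' \<noteq> []\<close> \<open>?T \<noteq> []\<close> unfolding AS_diffs_def by blast
  then have "int (c T') - int (c ?T) \<le> AS e c (length ?T)"
    unfolding AS_def using finite_AS_diffs[of c e] assms(4) by (intro Max_ge) auto
  moreover have "c ?T \<le> 2 * L + 2 + 2 * (L * L)"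
    using assms(4)[OF \<open>?T \<noteq> []\<close>] by (simp add: z_End_original[OF assms(1)])
  moreover have "3 * (L * L) \<le> c T'"
    using assms(3)[OF \<open>T' \<noteq> []\<close>] T'(2) by linarith
  ultimately show ?thesis by linarith
qed

theorem theorem5:
  fixes c :: "'a list \<Rightarrow> nat" and e :: edit
  assumes "infinite (UNIV :: 'a set)"
    and "\<And>T. T \<noteq> [] \<Longrightarrow> 0 < c T"
    and "\<And>T. T \<noteq> [] \<Longrightarrow> z_SSsr T \<le> c T"
    and "\<And>T. T \<noteq> [] \<Longrightarrow> c T \<le> z_End T"
  shows "\<exists>C > 0. \<exists>\<^sub>\<infinity>n. real_of_int (AS e c n) \<ge> C * real n powr (2 / 3)"
proof -
  obtain g :: "nat \<Rightarrow> 'a" where g: "inj g"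
    using infinite_countable_subset[OF assms(1)] by blast
  have "\<exists>n>m. real_of_int (AS e c n) \<ge> 1 / 8 * real n powr (2 / 3)" for m
  proof -
    \<comment> \<open>This gives \<open>n \<ge> 2 * L > m\<close>, and \<open>L \<ge> 5\<close>
      ensures \<open>2 * L + 2 \<le> L * L / 2\<close> over the reals.\<close>
    define L where "L = m + 5"
    define n where "n = length (original g L)"
    have L: "5 \<le> real L" by (simp add: L_def)
    have "m < n" using length_original(1)[OF g, of L] by (simp add: n_def L_def)
    have "real n \<le> 2 * (real L + 1) * (real L * real L + 1)"
      using length_original(2)[OF g, of L] unfolding n_def
      by (metis (mono_tags) of_nat_1 of_nat_add of_nat_le_iff of_nat_mult of_nat_numeral)
    \<comment> \<open>Rounding up to the cube of \<open>2 * L\<close> makes the power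
      \<open>2 / 3\<close> exactly \<open>4 * L * L\<close>; the factor \<open>1 / 8\<close> then
      leaves half of \<open>L * L\<close>.\<close>
    also have "\<dots> \<le> 2 * (2 * real L) * (2 * (real L * real L))"
      using L mult_mono[of 1 "real L" 1 "real L"] by (intro mult_mono) auto
    also have "\<dots> = (2 * real L) ^ 3" by (simp add: power3_eq_cube)
    finally have "real n powr (2 / 3) \<le> ((2 * real L) ^ 3) powr (2 / 3)"
      by (intro powr_mono2) auto
    also have "(2 * real L) ^ 3 = (2 * real L) powr 3"
      using L by simp
    also have "\<dots> powr (2 / 3) = (2 * real L) powr 2"
      by (simp only: powr_powr) simp
    also have "\<dots> = 4 * (real L * real L)"
      using L by (simp add: power2_eq_square)
    finally have "1 / 8 * real n powr (2 / 3) \<le> real L * real L / 2" by simp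
    also have "\<dots> \<le> real L * real L - 2 * real L - 2"
      using mult_right_mono[OF L, of "real L"] L by linarith
    also have "\<dots> = real_of_int (int (L * L) - 2 * int L - 2)" by simp
    also have "\<dots> \<le> real_of_int (AS e c n)"
      using AS_original[OF g _ assms(3,4), of L e] unfolding n_def
      by (simp only: of_int_le_iff) (simp add: L_def)
    finally show ?thesis using \<open>m < n\<close> by blast
  qed
  then have "\<exists>\<^sub>\<infinity>n. real_of_int (AS e c n) \<ge> 1 / 8 * real n powr (2 / 3)"
    by (simp add: INFM_nat)
  then show ?thesis by (intro exI[of _ "1 / 8"]) simp
qed

end
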